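(* Let $n\ge 2$ be an integer and let $d\in(0,1)$. Let $G$ be a random group on $n$ generators at density $d$, at length $L$, in the Gromov density model. Then with overwhelming probability $G$ has no non-trivial left-orderable quotients; that is, with $n$ and $d$ fixed, the probability that no non-trivial quotient group of $G$ is left-orderable tends to $1$ as $L\to\infty$ ($L\in\mathbb{N}_+$).
   Context: Let $F_n$ be the free group on $n\geq 2$ generators $a_1,\ldots,a_n$. For a positive integer $L$ let $R_L\subset F_n$ be the set of reduced words of length $L$ in the letters $a_1^{\pm1},\ldots,a_n^{\pm 1}$ (not assumed to be cyclically reduced). Let $d\in(0,1)$. A random set of relators at density $d$, at length $L$, is a sequence $R$ of $\lfloor (2n-1)^{dL}\rfloor$ elements of $R_L$, picked independently and uniformly at random from all elements of $R_L$ (repetitions allowed). A random group at density $d$, at length $L$, is the group $G=\langle S\mid R\rangle$, where $S=\{a_1,\ldots,a_n\}$ and $R$ is a random set of relators at density $d$, at length $L$. A property of random groups occurs with overwhelming probability (w.o.p.) at density $d$ if its probability of occurrence tends to $1$ as $L\to\infty$, for fixed $d$ (and fixed $n$). A group $G$ is left-ordered by $\leq$ if $\leq$ is a total order on $G$ which is left-invariant: for all $g_1,g_2,h\in G$, $g_1\leq g_2$ implies $hg_1\leq hg_2$. A group is left-orderable if it is left-ordered by some $\leq$. A non-trivial quotient is a quotient group which is not the trivial group. *)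

theory Defs
  imports "HOL-Probability.Probability" "HOL-Algebra.Algebra"
begin

text \<open>The pair \<open>(i, True)\<close> encodes the generator \<open>a\<^sub>i\<close>, and \<open>(i, False)\<close> its inverse;
  generators are indexed by \<open>0, \<dots>, n - 1\<close>.\<close>

type_synonym letter = "nat \<times> bool"
type_synonym word = "letter list"

definition inv_letter :: "letter \<Rightarrow> letter" where
  "inv_letter x = (fst x, \<not> snd x)"

definition freely_reduced :: "word \<Rightarrow> bool" where
  "freely_reduced w \<longleftrightarrow> successively (\<lambda>x y. y \<noteq> inv_letter x) w"

definition reduced_words :: "nat \<Rightarrow> word set" where
  "reduced_words n = {w. freely_reduced w \<and> fst ` set w \<subseteq> {..<n}}"

definition reduced_words_of_length :: "nat \<Rightarrow> nat \<Rightarrow> word set" where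
  "reduced_words_of_length n L = {w \<in> reduced_words n. length w = L}"

text \<open>Left multiplication of a reduced word by a letter, followed by free reduction; iterating it over the
  letters of \<open>u\<close> gives the product of \<open>u\<close> and a reduced word in the free group.\<close>

fun cons_letter :: "letter \<Rightarrow> word \<Rightarrow> word" where
  "cons_letter x [] = [x]"
| "cons_letter x (y # w) = (if y = inv_letter x then w else x # y # w)"

definition free_group :: "nat \<Rightarrow> word monoid" where
  "free_group n = \<lparr>carrier = reduced_words n, mult = foldr cons_letter, one = []\<rparr>"

definition normal_closure :: "('a, 'b) monoid_scheme \<Rightarrow> 'a set \<Rightarrow> 'a set" where
  "normal_closure G R = (\<lambda>N. N \<lhd> G) hull R"

definition presented_group :: "nat \<Rightarrow> word set \<Rightarrow> word set monoid" where
  "presented_group n R = free_group n Mod normal_closure (free_group n) R"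

definition random_relators :: "nat \<Rightarrow> real \<Rightarrow> nat \<Rightarrow> word list pmf" where
  "random_relators n d L =
     replicate_pmf (nat \<lfloor>(2 * real n - 1) powr (d * real L)\<rfloor>)
       (pmf_of_set (reduced_words_of_length n L))"

definition random_group :: "nat \<Rightarrow> real \<Rightarrow> nat \<Rightarrow> word set monoid pmf" where
  "random_group n d L = map_pmf (\<lambda>R. presented_group n (set R)) (random_relators n d L)"

definition with_overwhelming_probability ::
    "nat \<Rightarrow> real \<Rightarrow> (word set monoid \<Rightarrow> bool) \<Rightarrow> bool" where
  "with_overwhelming_probability n d P \<longleftrightarrow>
     (\<lambda>L. measure_pmf.prob (random_group n d L) {G. P G}) \<longlonglongrightarrow> 1"

definition left_ordered :: "('a, 'b) monoid_scheme \<Rightarrow> 'a rel \<Rightarrow> bool" where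
  "left_ordered G r \<longleftrightarrow> linear_order_on (carrier G) r \<and>
     (\<forall>g\<^sub>1\<in>carrier G. \<forall>g\<^sub>2\<in>carrier G. \<forall>h\<in>carrier G.
        (g\<^sub>1, g\<^sub>2) \<in> r \<longrightarrow> (h \<otimes>\<^bsub>G\<^esub> g\<^sub>1, h \<otimes>\<^bsub>G\<^esub> g\<^sub>2) \<in> r)"

definition left_orderable :: "('a, 'b) monoid_scheme \<Rightarrow> bool" where
  "left_orderable G \<longleftrightarrow> (\<exists>r. left_ordered G r)"


subsection \<open>Well-definedness\<close>

lemma inv_letter_simps [simp]:
  "inv_letter (inv_letter x) = x" "fst (inv_letter x) = fst x" "inv_letter x \<noteq> x"
  by (auto simp: inv_letter_def prod_eq_iff)

lemma inv_letter_swap: "x = inv_letter y \<longleftrightarrow> y = inv_letter x"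
  by auto

lemma reduced_simps [simp]:
  "freely_reduced []" "freely_reduced [x]"
  "freely_reduced (x # y # w) \<longleftrightarrow> y \<noteq> inv_letter x \<and> freely_reduced (y # w)"
  by (auto simp: freely_reduced_def)

lemma reduced_tl: "freely_reduced (x # w) \<Longrightarrow> freely_reduced w"
  by (cases w) auto

lemma reduced_cons_letter: "freely_reduced w \<Longrightarrow> freely_reduced (cons_letter x w)"
  by (cases w) (auto dest: reduced_tl)

lemma cons_letter_in: "fst x < n \<Longrightarrow> w \<in> reduced_words n \<Longrightarrow> cons_letter x w \<in> reduced_words n"
  unfolding reduced_words_def using reduced_cons_letter[of w x] by (cases w) auto

lemma cons_letter_inv: "freely_reduced w \<Longrightarrow> cons_letter x (cons_letter (inv_letter x) w) = w"
  by (cases w; cases "tl w") auto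

lemma cons_letter_reduced: "freely_reduced (x # w) \<Longrightarrow> cons_letter x w = x # w"
  by (cases w) auto

lemma foldr_append_reduced: "freely_reduced (u @ v) \<Longrightarrow> foldr cons_letter u v = u @ v"
proof (induction u)
  case (Cons x u)
  then show ?case using reduced_tl[of x "u @ v"] cons_letter_reduced[of x "u @ v"] by simp
qed auto

lemma reduced_foldr: "freely_reduced v \<Longrightarrow> freely_reduced (foldr cons_letter u v)"
  by (induction u) (auto intro: reduced_cons_letter)

lemma foldr_cons_letter:
  assumes "freely_reduced v"
  shows "foldr cons_letter (cons_letter x u) v = cons_letter x (foldr cons_letter u v)"
proof (cases u)
  case (Cons y w)
  then show ?thesis
    using cons_letter_inv[OF reduced_foldr[OF assms], of x w] by auto
qed auto

lemma group_free_group: "group (free_group n)"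
proof (rule groupI)
  fix u v assume "u \<in> carrier (free_group n)" "v \<in> carrier (free_group n)"
  then have "fst ` set u \<subseteq> {..<n}" "v \<in> reduced_words n"
    by (auto simp: free_group_def reduced_words_def)
  then show "u \<otimes>\<^bsub>free_group n\<^esub> v \<in> carrier (free_group n)"
    by (induction u) (auto simp: free_group_def intro: cons_letter_in)
next
  fix u v w
  assume "w \<in> carrier (free_group n)"
  then have "freely_reduced w" by (simp add: free_group_def reduced_words_def)
  then have "foldr cons_letter (foldr cons_letter u v) w = foldr cons_letter u (foldr cons_letter v w)"
    by (induction u) (auto simp: foldr_cons_letter)
  then show "u \<otimes>\<^bsub>free_group n\<^esub> v \<otimes>\<^bsub>free_group n\<^esub> w = u \<otimes>\<^bsub>free_group n\<^esub> (v \<otimes>\<^bsub>free_group n\<^esub> w)"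
    by (simp add: free_group_def)
next
  fix u assume u: "u \<in> carrier (free_group n)"
  define v where "v = rev (map inv_letter u)"
  have "freely_reduced v"
    using u unfolding v_def freely_reduced_def free_group_def reduced_words_def
    by (auto simp: successively_map intro: successively_mono dest: inv_letter_swap[THEN iffD1])
  then have v: "v \<in> carrier (free_group n)"
    using u by (auto simp: v_def free_group_def reduced_words_def image_iff)
  have "foldr cons_letter (rev (map inv_letter u)) u = []"
  proof -
    have "foldr cons_letter (rev (map inv_letter u)) (u @ w) = w" for w
      by (induction u) auto
    from this[of "[]"] show ?thesis by simp
  qed
  then show "\<exists>v\<in>carrier (free_group n). v \<otimes>\<^bsub>free_group n\<^esub> u = \<one>\<^bsub>free_group n\<^esub>"
    using v unfolding v_def free_group_def by auto
qed (auto simp: free_group_def reduced_words_def)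

lemma (in group) normal_normal_closure:
  assumes "R \<subseteq> carrier G"
  shows "normal_closure G R \<lhd> G"
proof -
  let ?C = "{N. N \<lhd> G \<and> R \<subseteq> N}"
  have "carrier G \<lhd> G"
    by (rule normal_invI) (auto simp: subgroup_self)
  with assms have "subgroup (\<Inter>?C) G"
    by (intro subgroups_Inter) (auto dest: normal_imp_subgroup)
  then have "\<Inter>?C \<lhd> G"
    by (rule normal_invI) (auto dest: normal.inv_op_closed2)
  then show ?thesis by (simp add: normal_closure_def hull_def)
qed

lemma group_presented_group: "R \<subseteq> reduced_words n \<Longrightarrow> group (presented_group n R)"
  unfolding presented_group_def
  by (rule normal.factorgroup_is_group, rule group.normal_normal_closure[OF group_free_group])
     (simp add: free_group_def)

lemma finite_reduced_words_of_length: "finite (reduced_words_of_length n L)"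
  by (rule finite_subset[OF _ finite_lists_length_eq[of "{..<n} \<times> UNIV" L]])
     (auto simp: reduced_words_of_length_def reduced_words_def)

lemma reduced_words_of_length_nonempty:
  assumes "n \<ge> 1"
  shows "reduced_words_of_length n L \<noteq> {}"
proof -
  have "freely_reduced (replicate L (0, True))"
    by (induction L rule: induct_nat_012) (auto simp: inv_letter_def)
  then have "replicate L (0, True) \<in> reduced_words_of_length n L"
    using assms by (auto simp: reduced_words_of_length_def reduced_words_def)
  then show ?thesis by blast
qed

end

theory Submission
  imports Defs "HOL-Real_Asymp.Real_Asymp"
begin

text \<open>Fix \<open>k > 1 / d\<close> and cut each relator into blocks of length \<open>k\<close>, except that the second block
  may be shorter. In a left-ordered quotient, one of \<open>w\<close>, \<open>w\<inverse>\<close> has image \<open>\<ge> 1\<close> for every word \<open>w\<close>, so the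
  set \<open>T\<close> of words of length at most \<open>k\<close> with image \<open>\<ge> 1\<close> contains at least a third of the reduced
  continuations of any word. Hence, for a given \<open>v\<close> of length \<open>k\<close>, a random relator consists of \<open>v\<close>
  followed by blocks from \<open>T\<close> with probability at least a constant times
  \<open>3\<^bsup>-L/k\<^esup>\<close>, which exceeds \<open>(2n - 1)\<^bsup>-dL\<^esup>\<close> by an exponential factor.
  There are only finitely many pairs \<open>(T, v)\<close>, so with overwhelming probability every pair is
  realised by a relator. Such a relator forces the image of \<open>v\<close> to be \<open>\<le> 1\<close>; applied to \<open>v\<inverse>\<close> as well,
  this makes all words of length \<open>k\<close> trivial. Comparing \<open>x y\<^bsup>k-1\<^esup>\<close> with
  \<open>x\<inverse> y\<^bsup>k-1\<^esup>\<close> for distinct generators gives \<open>x\<^sup>2 = 1\<close>, and a left-orderable group is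
  torsion-free.\<close>

section \<open>Counting reduced words\<close>

lemma reduced_words_of_length_hd_Suc_Suc:
  assumes "fst x < n"
  shows "{w \<in> reduced_words_of_length n (Suc (Suc b)). hd w = x} =
    (#) x ` (\<Union>y \<in> {..<n} \<times> UNIV - {inv_letter x}. {w \<in> reduced_words_of_length n (Suc b). hd w = y})"
    (is "?A = ?B")
proof
  show "?A \<subseteq> ?B"
  proof
    fix w assume "w \<in> ?A"
    then obtain y u where "w = x # y # u" and w: "w \<in> reduced_words_of_length n (Suc (Suc b))"
      by (auto simp: reduced_words_of_length_def length_Suc_conv)
    then show "w \<in> ?B"
      by (auto simp: reduced_words_of_length_def reduced_words_def mem_Times_iff intro!: imageI)
  qed
  show "?B \<subseteq> ?A"
    using assms
    by (auto simp: reduced_words_of_length_def reduced_words_def length_Suc_conv image_subset_iff)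
qed

text \<open>After the first letter every position has \<open>2 * n - 1\<close> choices, all letters
  but the inverse of the preceding one. Fixing the first letter also serves to count the
  continuations that cancel against a given word.\<close>

lemma card_reduced_words_of_length_hd:
  assumes "n \<ge> 1" "fst x < n"
  shows "card {w \<in> reduced_words_of_length n (Suc b). hd w = x} = (2 * n - 1) ^ b"
  using assms(2)
proof (induction b arbitrary: x)
  case 0
  then have "{w \<in> reduced_words_of_length n (Suc 0). hd w = x} = {[x]}"
    by (auto simp: reduced_words_of_length_def reduced_words_def length_Suc_conv)
  then show ?case by simp
next
  case (Suc b)
  let ?Y = "{..<n} \<times> UNIV - {inv_letter x}"
  let ?W = "\<lambda>y. {w \<in> reduced_words_of_length n (Suc b). hd w = y}"
  have "card {w \<in> reduced_words_of_length n (Suc (Suc b)). hd w = x} = card (\<Union>y\<in>?Y. ?W y)"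
    unfolding reduced_words_of_length_hd_Suc_Suc[OF Suc.prems] by (rule card_image) auto
  also have "\<dots> = (\<Sum>y\<in>?Y. card (?W y))"
    by (rule card_UN_disjoint) (auto simp: finite_reduced_words_of_length)
  also have "\<dots> = (\<Sum>y\<in>?Y. (2 * n - 1) ^ b)"
    by (rule sum.cong) (auto simp: Suc.IH)
  also have "\<dots> = card ?Y * (2 * n - 1) ^ b" by simp
  also have "card ?Y = 2 * n - 1"
    using Suc.prems by (subst card_Diff_singleton) (auto simp: card_cartesian_product mem_Times_iff)
  finally show ?case by simp
qed

lemma card_reduced_words_of_length:
  assumes "n \<ge> 1"
  shows "card (reduced_words_of_length n (Suc b)) = 2 * n * (2 * n - 1) ^ b"
proof -
  let ?W = "\<lambda>y. {w \<in> reduced_words_of_length n (Suc b). hd w = y}"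
  have "reduced_words_of_length n (Suc b) = (\<Union>y\<in>{..<n} \<times> UNIV. ?W y)"
    by (auto simp: reduced_words_of_length_def reduced_words_def length_Suc_conv)
  also have "card \<dots> = (\<Sum>y\<in>{..<n} \<times> (UNIV :: bool set). card (?W y))"
    by (rule card_UN_disjoint) (auto simp: finite_reduced_words_of_length)
  also have "\<dots> = (\<Sum>y\<in>{..<n} \<times> (UNIV :: bool set). (2 * n - 1) ^ b)"
    using assms by (intro sum.cong) (auto simp: card_reduced_words_of_length_hd)
  also have "\<dots> = 2 * n * (2 * n - 1) ^ b" by (simp add: card_cartesian_product)
  finally show ?thesis .
qed


section \<open>Relators made of blocks\<close>

definition inv_word :: "word \<Rightarrow> word" where
  "inv_word w = rev (map inv_letter w)"

lemma length_inv_word [simp]: "length (inv_word w) = length w"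
  by (simp add: inv_word_def)

lemma inv_word_inv_word [simp]: "inv_word (inv_word w) = w"
  by (simp add: inv_word_def rev_map comp_def)

lemma inv_word_in:
  assumes "w \<in> reduced_words n"
  shows "inv_word w \<in> reduced_words n"
proof -
  have "freely_reduced (inv_word w)"
    using assms unfolding inv_word_def freely_reduced_def reduced_words_def
    by (auto simp: successively_map intro: successively_mono dest: inv_letter_swap[THEN iffD1])
  then show ?thesis
    using assms by (auto simp: inv_word_def reduced_words_def image_iff)
qed

lemma foldr_inv_word: "foldr cons_letter (inv_word w) w = []"
proof -
  have "foldr cons_letter (rev (map inv_letter w)) (w @ u) = u" for u
    by (induction w) auto
  from this[of "[]"] show ?thesis by (simp add: inv_word_def)
qed

text \<open>The combinatorial trace of a left order on the ball of radius \<open>k\<close>: the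
  words with image \<ge> 1. Both \<open>w\<close> and \<open>inv_word w\<close> may belong, as when
  the image is 1.\<close>

definition half_system :: "nat \<Rightarrow> nat \<Rightarrow> word set \<Rightarrow> bool" where
  "half_system n k T \<longleftrightarrow> T \<subseteq> {w \<in> reduced_words n. length w \<le> k} \<and>
     (\<forall>w \<in> reduced_words n. length w \<le> k \<longrightarrow> w \<in> T \<or> inv_word w \<in> T)"

text \<open>Blocks are joined by plain concatenation; absence of cancellation is imposed separately,
  by intersecting with the reduced words.\<close>

inductive_set block_words :: "word set \<Rightarrow> word \<Rightarrow> word set" for T v where
  start: "v \<in> block_words T v"
| extend: "w \<in> block_words T v \<Longrightarrow> u \<in> T \<Longrightarrow> w @ u \<in> block_words T v"

lemma finite_half_systems: "finite {T. half_system n k T}"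
proof -
  have "{w \<in> reduced_words n. length w \<le> k} = (\<Union>j\<le>k. reduced_words_of_length n j)"
    by (auto simp: reduced_words_of_length_def)
  then have "finite {w \<in> reduced_words n. length w \<le> k}"
    by (simp add: finite_reduced_words_of_length)
  then show ?thesis
    by (rule rev_finite_subset[OF finite_Pow_iff[THEN iffD2]]) (auto simp: half_system_def)
qed

lemma card_half_system:
  assumes "half_system n k T" "b \<le> k"
  shows "card (reduced_words_of_length n b) \<le> 2 * card (T \<inter> reduced_words_of_length n b)"
proof -
  let ?A = "T \<inter> reduced_words_of_length n b"
  have fin: "finite ?A" by (simp add: finite_reduced_words_of_length)
  have "reduced_words_of_length n b \<subseteq> ?A \<union> inv_word ` ?A"
  proof
    fix w assume w: "w \<in> reduced_words_of_length n b"
    then have "inv_word w \<in> reduced_words_of_length n b"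
      by (auto simp: reduced_words_of_length_def inv_word_in)
    moreover have "w \<in> T \<or> inv_word w \<in> T"
      using w assms by (auto simp: half_system_def reduced_words_of_length_def)
    ultimately show "w \<in> ?A \<union> inv_word ` ?A"
      using w by (metis Int_iff UnCI image_eqI inv_word_inv_word)
  qed
  then have "card (reduced_words_of_length n b) \<le> card (?A \<union> inv_word ` ?A)"
    by (rule card_mono[rotated]) (use fin in auto)
  also have "\<dots> \<le> card ?A + card (inv_word ` ?A)" by (rule card_Un_le)
  also have "card (inv_word ` ?A) \<le> card ?A" using fin by (rule card_image_le)
  finally show ?thesis by simp
qed

text \<open>Half of all words of length \<open>b + 1\<close> number
  \<open>n * (2 * n - 1) ^ b\<close>, and only \<open>(2 * n - 1) ^ b\<close> words begin with the
  one letter that cancels against the end of \<open>w\<close>.\<close>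

lemma card_half_system_extensions:
  assumes "n \<ge> 2" "half_system n k T" "Suc b \<le> k" "w \<in> reduced_words n" "w \<noteq> []"
  shows "(2 * n - 1) ^ Suc b \<le>
    3 * card {u \<in> T \<inter> reduced_words_of_length n (Suc b). freely_reduced (w @ u)}"
proof -
  let ?A = "T \<inter> reduced_words_of_length n (Suc b)"
  let ?x = "inv_letter (last w)"
  let ?H = "{u \<in> reduced_words_of_length n (Suc b). hd u = ?x}"
  have "last w \<in> set w" using assms(5) by simp
  then have "fst ` {last w} \<subseteq> {..<n}" using assms(4) by (auto simp: reduced_words_def)
  then have H: "card ?H = (2 * n - 1) ^ b"
    using assms(1) by (intro card_reduced_words_of_length_hd) auto
  have "?A - ?H \<subseteq> {u \<in> ?A. freely_reduced (w @ u)}"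
    using assms(4,5)
    by (auto simp: reduced_words_of_length_def reduced_words_def freely_reduced_def
        successively_append_iff)
  then have "card (?A - ?H) \<le> card {u \<in> ?A. freely_reduced (w @ u)}"
    by (rule card_mono[rotated]) (simp add: finite_reduced_words_of_length)
  moreover have "card ?A - card ?H \<le> card (?A - ?H)"
    by (rule diff_card_le_card_Diff) (simp add: finite_reduced_words_of_length)
  moreover have "2 * n * (2 * n - 1) ^ b \<le> 2 * card ?A"
    using card_half_system[OF assms(2,3)] card_reduced_words_of_length[of n b] assms(1) by simp
  ultimately have
    "(n - 1) * (2 * n - 1) ^ b \<le> card {u \<in> ?A. freely_reduced (w @ u)}"
    using H by (simp add: diff_mult_distrib)
  \<comment> \<open>The constant 3 arises here: \<open>2 * n - 1 \<le> 3 * (n - 1)\<close> holds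
    because \<open>n \<ge> 2\<close>, with equality at \<open>n = 2\<close>.\<close>
  moreover have "(2 * n - 1) * (2 * n - 1) ^ b \<le> (3 * (n - 1)) * (2 * n - 1) ^ b"
    using assms(1) by (intro mult_right_mono) linarith+
  ultimately show ?thesis
    unfolding power_Suc mult.assoc by linarith
qed

lemma card_block_words_extend:
  assumes "n \<ge> 2" "half_system n k T" "1 \<le> b" "b \<le> k" "1 \<le> a"
  shows "card (block_words T v \<inter> reduced_words_of_length n a) * (2 * n - 1) ^ b \<le>
    3 * card (block_words T v \<inter> reduced_words_of_length n (a + b))"
proof -
  let ?B = "\<lambda>L. block_words T v \<inter> reduced_words_of_length n L"
  let ?U = "\<lambda>w. {u \<in> T \<inter> reduced_words_of_length n b. freely_reduced (w @ u)}"
  have U: "(2 * n - 1) ^ b \<le> 3 * card (?U w)" if "w \<in> ?B a" for w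
  proof -
    from assms(3) obtain b' where b': "b = Suc b'" by (cases b) auto
    have "w \<in> reduced_words n" "w \<noteq> []"
      using that assms(5) by (auto simp: reduced_words_of_length_def)
    then show ?thesis
      using assms(4) unfolding b' by (intro card_half_system_extensions[OF assms(1,2)])
  qed
  have "card (?B a) * (2 * n - 1) ^ b = (\<Sum>w\<in>?B a. (2 * n - 1) ^ b)" by simp
  also have "\<dots> \<le> (\<Sum>w\<in>?B a. 3 * card (?U w))" by (rule sum_mono) (rule U)
  also have "\<dots> = 3 * card (SIGMA w:?B a. ?U w)"
    by (subst card_SigmaI) (auto simp: finite_reduced_words_of_length sum_distrib_left)
  \<comment> \<open>All left factors have length \<open>a\<close>, so a concatenation determines
    where it splits.\<close>
  also have "card (SIGMA w:?B a. ?U w) = card ((\<lambda>(w, u). w @ u) ` (SIGMA w:?B a. ?U w))"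
    by (rule card_image[symmetric]) (auto simp: inj_on_def reduced_words_of_length_def)
  also have "\<dots> \<le> card (?B (a + b))"
  proof (rule card_mono)
    show "finite (?B (a + b))" by (simp add: finite_reduced_words_of_length)
  qed (auto simp: reduced_words_of_length_def reduced_words_def image_subset_iff ball_Un
      intro: block_words.extend)
  finally show ?thesis by simp
qed

text \<open>Peeling off the last block costs a factor 3. The exponent \<open>(L - 1) div k\<close>
  is \<open>L / k\<close> rounded up, minus 1: the number of blocks after \<open>v\<close>.\<close>

lemma card_block_words:
  assumes "n \<ge> 2" "half_system n k T" "1 \<le> k" "v \<in> reduced_words_of_length n k" "k \<le> L"
  shows "(2 * n - 1) ^ (L - k) \<le>
    3 ^ ((L - 1) div k) * card (block_words T v \<inter> reduced_words_of_length n L)"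
  using assms(5)
proof (induction L rule: less_induct)
  case (less L)
  let ?B = "\<lambda>L. block_words T v \<inter> reduced_words_of_length n L"
  show ?case
  proof (cases "L = k")
    case True
    have "v \<in> ?B k" using assms(4) by (auto intro: block_words.start)
    then have "card (?B k) \<noteq> 0" by (auto simp: finite_reduced_words_of_length)
    then show ?thesis using True assms(3) by simp
  next
    case False
    \<comment> \<open>The last block is full while \<open>L \<ge> 2 * k\<close>; otherwise it has
      length \<open>L - k\<close> and directly follows \<open>v\<close>. So the remaining length
      never drops below \<open>k\<close>.\<close>
    define b where "b = min k (L - k)"
    have b: "1 \<le> b" "b \<le> k" "k \<le> L - b" "1 \<le> L - b" "L - b < L" "L - b + b = L"
      using False less.prems assms(3) by (auto simp: b_def)
    have e: "Suc ((L - b - 1) div k) = (L - 1) div k"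
    proof (cases "L \<le> 2 * k")
      case True
      then have "L - b = k" using less.prems by (simp add: b_def)
      moreover have "(L - 1) div k = 1"
        using True False less.prems assms(3) by (intro div_nat_eqI) auto
      ultimately show ?thesis using assms(3) by simp
    next
      case False
      then have "b = k" by (simp add: b_def)
      have "(L - 1) div k = (L - k - 1 + k) div k"
        by (rule arg_cong[where f = "\<lambda>x. x div k"]) (use False assms(3) in simp)
      also have "\<dots> = Suc ((L - k - 1) div k)" using assms(3) by simp
      finally show ?thesis by (simp add: \<open>b = k\<close>)
    qed
    have "(2 * n - 1) ^ (L - k) = (2 * n - 1) ^ (L - b - k) * (2 * n - 1) ^ b"
      using b by (subst power_add[symmetric]) simp
    also have "\<dots> \<le> 3 ^ ((L - b - 1) div k) * card (?B (L - b)) * (2 * n - 1) ^ b"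
      by (rule mult_right_mono[OF less.IH]) (use b in auto)
    also have "\<dots> \<le> 3 ^ ((L - b - 1) div k) * (3 * card (?B (L - b + b)))"
      using card_block_words_extend[OF assms(1,2) b(1,2,4), of v]
      by (simp add: mult.assoc)
    also have "\<dots> = 3 ^ Suc ((L - b - 1) div k) * card (?B L)" using b(6) by simp
    finally show ?thesis unfolding e .
  qed
qed


section \<open>Random relators contain block words\<close>

text \<open>The draws are independent and each misses \<open>B\<close> with the same
  probability.\<close>

lemma prob_replicate_pmf_disjoint:
  fixes p :: "'a :: countable pmf"
  shows "measure_pmf.prob (replicate_pmf M p) {R. set R \<inter> B = {}} =
    (1 - measure_pmf.prob p B) ^ M"
proof (induction M)
  case 0
  then show ?case by simp
next
  case (Suc M)
  have "replicate_pmf (Suc M) p = map_pmf (\<lambda>(x, xs). x # xs) (pair_pmf p (replicate_pmf M p))"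
    by (simp add: pair_pmf_def map_pmf_def bind_assoc_pmf bind_return_pmf)
  moreover have "(\<lambda>(x, xs). x # xs) -` {R. set R \<inter> B = {}} = (- B) \<times> {R. set R \<inter> B = {}}"
    by auto
  moreover have "measure_pmf.prob p (- B) = 1 - measure_pmf.prob p B"
    using measure_pmf.prob_compl[of B p] by (simp add: Compl_eq_Diff_UNIV)
  ultimately show ?case
    using Suc.IH by (simp add: measure_pmf_prob_product)
qed

text \<open>With \<open>q = 2 * n - 1\<close>, there are at least
  \<open>q ^ (L - k) / 3 ^ ((L - 1) div k)\<close> block words among at most
  \<open>2 * q ^ L\<close> reduced words.\<close>

lemma prob_block_words:
  assumes "n \<ge> 2" "half_system n k T" "1 \<le> k" "v \<in> reduced_words_of_length n k" "k \<le> L"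
  shows "(2 * real n - 1) powr (- real k - real L / real k) / 2 \<le>
    measure_pmf.prob (pmf_of_set (reduced_words_of_length n L)) (block_words T v)"
proof -
  define q where "q = 2 * real n - 1"
  have q: "q \<ge> 3" "real (2 * n - 1) = q" using assms(1) by (auto simp: q_def of_nat_diff)
  let ?R = "reduced_words_of_length n L"
  let ?e = "(L - 1) div k"
  from assms(3,5) obtain L' where L': "L = Suc L'" by (cases L) auto
  have "card ?R = 2 * n * (2 * n - 1) ^ L'"
    unfolding L' using assms(1) by (intro card_reduced_words_of_length) simp
  then have "real (card ?R) = (q + 1) * q ^ L'"
    using q by (simp add: q_def)
  also have "\<dots> \<le> (2 * q) * q ^ L'" using q by (intro mult_right_mono) auto
  finally have R: "real (card ?R) \<le> 2 * q ^ L" by (simp add: L')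
  have R0: "real (card ?R) > 0"
    using reduced_words_of_length_nonempty[of n L] assms(1)
    by (simp add: card_gt_0_iff finite_reduced_words_of_length)
  have "real ?e \<le> real (L - 1) / real k" by (rule of_nat_div_le_of_nat)
  also have "\<dots> \<le> real L / real k" by (rule divide_right_mono) auto
  finally have e: "real ?e \<le> real L / real k" .
  \<comment> \<open>Weakening 3 to \<open>q\<close> expresses everything in powers of
    \<open>q\<close>, so that the number of relators is compared with this bound through the
    exponents \<open>d\<close> and \<open>1 / k\<close> alone.\<close>
  have "(3::real) ^ ?e \<le> q ^ ?e" using q by (intro power_mono) auto
  also have "\<dots> = q powr real ?e" using q by (simp add: powr_realpow)
  also have "\<dots> \<le> q powr (real L / real k)" using e q by (intro powr_mono) auto
  finally have three: "3 ^ ?e \<le> q powr (real L / real k)" .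
  define C where "C = real (card (block_words T v \<inter> ?R))"
  have "real ((2 * n - 1) ^ (L - k)) \<le> real (3 ^ ?e * card (block_words T v \<inter> ?R))"
    using card_block_words[OF assms] by (rule of_nat_mono)
  then have "q ^ (L - k) \<le> 3 ^ ?e * C" by (simp only: of_nat_power of_nat_mult q C_def) simp
  also have "\<dots> \<le> q powr (real L / real k) * C"
    using three by (intro mult_right_mono) (auto simp: C_def)
  finally have C: "q powr (real L - real k) \<le> q powr (real L / real k) * C"
    using q assms(5) by (simp add: of_nat_diff flip: powr_realpow)
  have "q powr (- real k - real L / real k) / 2 * real (card ?R)
      \<le> q powr (- real k - real L / real k) / 2 * (2 * q ^ L)"
    using R by (intro mult_left_mono) auto
  also have "\<dots> = q powr (- (real L / real k)) * q powr (real L - real k)"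
    using q by (simp add: field_simps powr_diff powr_minus powr_add powr_realpow)
  also have "\<dots> \<le> q powr (- (real L / real k)) * (q powr (real L / real k) * C)"
    using C by (intro mult_left_mono) auto
  also have "\<dots> = C" using q by (simp add: powr_minus)
  finally have "q powr (- real k - real L / real k) / 2 \<le> C / real (card ?R)"
    using R0 by (simp add: field_simps)
  then show ?thesis
    using reduced_words_of_length_nonempty[of n L] assms(1)
    by (simp add: measure_pmf_of_set finite_reduced_words_of_length C_def q_def Int_commute)
qed

text \<open>If one relator hits with probability \<open>p\<close>, then \<open>M\<close> relators
  all miss with probability \<open>(1 - p) ^ M \<le> exp (- (p * M))\<close>, and
  \<open>p * M\<close> grows exponentially because \<open>1 / k < d\<close>.\<close>

lemma prob_no_block_relator_tendsto:
  assumes "n \<ge> 2" "half_system n k T" "1 \<le> k" "v \<in> reduced_words_of_length n k" "1 / real k < d"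
  shows "(\<lambda>L. measure_pmf.prob (random_relators n d L) {R. set R \<inter> block_words T v = {}})
    \<longlonglongrightarrow> 0"
proof -
  define q where "q = 2 * real n - 1"
  define c where "c = q powr (- real k) / 2"
  define a where "a = (d - 1 / real k) * ln q"
  have q: "q \<ge> 3" using assms(1) by (auto simp: q_def)
  then have ca: "c > 0" "a > 0" using assms(5) by (auto simp: c_def a_def)
  let ?f = "\<lambda>L. measure_pmf.prob (random_relators n d L) {R. set R \<inter> block_words T v = {}}"
  have bound: "?f L \<le> exp (- (c * (exp (a * real L) - 1)))" if "k \<le> L" for L
  proof -
    define p where
      "p = measure_pmf.prob (pmf_of_set (reduced_words_of_length n L)) (block_words T v)"
    define M where "M = nat \<lfloor>q powr (d * real L)\<rfloor>"
    have p: "0 \<le> p" "p \<le> 1" by (auto simp: p_def)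
    \<comment> \<open>The subtracted 1 pays for the floor in \<open>M\<close>: the floor loses at
      most one relator, which contributes at most
      \<open>c * q powr (- (L / k)) \<le> c\<close>.\<close>
    have "c * (exp (a * real L) - 1) \<le> c * (exp (a * real L) - q powr (- (real L / real k)))"
    proof -
      have "q powr (- (real L / real k)) \<le> q powr 0" using q by (intro powr_mono) auto
      then show ?thesis using q ca by (intro mult_left_mono) auto
    qed
    also have "c * (exp (a * real L) - q powr (- (real L / real k)))
      = c * (q powr (d * real L) * q powr (- (real L / real k)) - q powr (- (real L / real k)))"
      using q by (simp add: powr_def a_def algebra_simps flip: exp_add)
    also have "\<dots> = q powr (- real k - real L / real k) / 2 * (q powr (d * real L) - 1)"
      using q by (simp add: c_def powr_diff powr_minus field_simps)
    also have "\<dots> \<le> p * (q powr (d * real L) - 1)"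
    proof (rule mult_right_mono)
      show "q powr (- real k - real L / real k) / 2 \<le> p"
        unfolding p_def q_def by (rule prob_block_words[OF assms(1-4) that])
      have "d * real L \<ge> 0" using assms(3,5) by (smt (verit) divide_nonneg_nonneg mult_nonneg_nonneg of_nat_0_le_iff)
      then show "0 \<le> q powr (d * real L) - 1" using q by (simp add: ge_one_powr_ge_zero)
    qed
    also have "\<dots> \<le> p * real M"
    proof (rule mult_left_mono)
      show "q powr (d * real L) - 1 \<le> real M" unfolding M_def by linarith
    qed (use p in simp)
    finally have pM: "c * (exp (a * real L) - 1) \<le> p * real M" .
    have "?f L = (1 - p) ^ M"
      by (simp add: random_relators_def prob_replicate_pmf_disjoint p_def M_def q_def)
    also have "\<dots> \<le> exp (- p) ^ M"
      using p exp_ge_add_one_self[of "- p"] by (intro power_mono) auto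
    also have "\<dots> = exp (- (p * real M))" by (simp flip: exp_of_nat2_mult)
    also have "\<dots> \<le> exp (- (c * (exp (a * real L) - 1)))" using pM by simp
    finally show ?thesis .
  qed
  show ?thesis
  proof (rule tendsto_sandwich[OF _ _ tendsto_const])
    show "\<forall>\<^sub>F L in sequentially. ?f L \<le> exp (- (c * (exp (a * real L) - 1)))"
      using eventually_ge_at_top[of k] by eventually_elim (rule bound)
    show "(\<lambda>L. exp (- (c * (exp (a * real L) - 1)))) \<longlonglongrightarrow> 0"
      using ca by real_asymp
  qed auto
qed


section \<open>Left-ordered images of the free group\<close>

text \<open>If \<open>x \<ge> 1\<close>, left multiplication by \<open>x\<close> gives
  \<open>1 = x * x \<ge> x\<close>; the case \<open>x \<le> 1\<close> is symmetric.\<close>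

lemma left_ordered_square_one:
  assumes "group Q" "left_ordered Q r" "x \<in> carrier Q" "x \<otimes>\<^bsub>Q\<^esub> x = \<one>\<^bsub>Q\<^esub>"
  shows "x = \<one>\<^bsub>Q\<^esub>"
proof -
  interpret group Q by fact
  have r: "total_on (carrier Q) r" "antisym r" "refl_on (carrier Q) r"
    using assms(2) by (auto simp: left_ordered_def linear_order_on_def partial_order_on_def preorder_on_def)
  have mono: "(x \<otimes>\<^bsub>Q\<^esub> g, x \<otimes>\<^bsub>Q\<^esub> h) \<in> r" if "(g, h) \<in> r" "g \<in> carrier Q" "h \<in> carrier Q" for g h
    using assms(2,3) that by (auto simp: left_ordered_def)
  have "(\<one>\<^bsub>Q\<^esub>, x) \<in> r \<or> (x, \<one>\<^bsub>Q\<^esub>) \<in> r"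
    using r(1,3) assms(3) by (metis one_closed refl_onD total_on_def)
  then show ?thesis
    using mono[of "\<one>\<^bsub>Q\<^esub>" x] mono[of x "\<one>\<^bsub>Q\<^esub>"] assms(3,4) r(2) by (auto dest: antisymD)
qed

text \<open>Where nothing cancels, concatenation is the product of the free group; this passes from
  block words to products in \<open>Q\<close>.\<close>

lemma hom_append:
  assumes "\<phi> \<in> hom (free_group n) Q" "w @ u \<in> reduced_words n"
  shows "w \<in> reduced_words n" "u \<in> reduced_words n" "\<phi> (w @ u) = \<phi> w \<otimes>\<^bsub>Q\<^esub> \<phi> u"
proof -
  show wu: "w \<in> reduced_words n" "u \<in> reduced_words n"
    using assms(2) by (auto simp: reduced_words_def freely_reduced_def successively_append_iff)
  have "w \<otimes>\<^bsub>free_group n\<^esub> u = w @ u"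
    using assms(2) by (simp add: free_group_def foldr_append_reduced reduced_words_def)
  then show "\<phi> (w @ u) = \<phi> w \<otimes>\<^bsub>Q\<^esub> \<phi> u"
    using hom_mult[OF assms(1), of w u] wu by (simp add: free_group_def)
qed

lemma hom_inv_word:
  assumes "group Q" "\<phi> \<in> hom (free_group n) Q" "w \<in> reduced_words n"
  shows "\<phi> (inv_word w) \<otimes>\<^bsub>Q\<^esub> \<phi> w = \<one>\<^bsub>Q\<^esub>"
proof -
  interpret group_hom "free_group n" Q \<phi>
    using assms(1,2) by (simp add: group_hom_def group_hom_axioms_def group_free_group)
  have "inv_word w \<otimes>\<^bsub>free_group n\<^esub> w = \<one>\<^bsub>free_group n\<^esub>"
    by (simp add: free_group_def foldr_inv_word)
  then show ?thesis
    using hom_mult[of "inv_word w" w] assms(3) hom_one inv_word_in[OF assms(3)]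
    by (simp add: free_group_def)
qed

lemma hom_trivial_if_trivial_on_length:
  assumes "n \<ge> 2" "1 \<le> k" "group Q" "left_ordered Q r" "\<phi> \<in> hom (free_group n) Q"
    and triv: "\<And>w. w \<in> reduced_words_of_length n k \<Longrightarrow> \<phi> w = \<one>\<^bsub>Q\<^esub>"
    and "w \<in> reduced_words n"
  shows "\<phi> w = \<one>\<^bsub>Q\<^esub>"
proof -
  interpret group_hom "free_group n" Q \<phi>
    using assms(3,5) by (simp add: group_hom_def group_hom_axioms_def group_free_group)
  have car: "\<phi> u \<in> carrier Q" if "u \<in> reduced_words n" for u
    using that hom_closed by (simp add: free_group_def)
  have letter: "\<phi> [x] = \<one>\<^bsub>Q\<^esub>" if x: "fst x < n" for x
  proof -
    \<comment> \<open>A generator other than that of \<open>x\<close>, available since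
      \<open>n \<ge> 2\<close>, so that neither \<open>x\<close> nor its inverse cancels against
      \<open>?u\<close>. For \<open>k = 1\<close> the word \<open>?u\<close> is empty.\<close>
    define i :: nat where "i = (if fst x = 0 then 1 else 0)"
    let ?u = "replicate (k - 1) (i, True)"
    have red: "freely_reduced (replicate m (i, True))" for m
      by (induction m rule: induct_nat_012) (auto simp: inv_letter_def)
    have in_k: "[y] @ ?u \<in> reduced_words_of_length n k" if "fst y = fst x" for y
      using that x red[of "k - 1"] assms(1,2)
      by (cases "k - 1")
         (auto simp: reduced_words_of_length_def reduced_words_def i_def inv_letter_def)
    have y: "[y] \<in> reduced_words n" "?u \<in> reduced_words n" "\<phi> [y] \<otimes>\<^bsub>Q\<^esub> \<phi> ?u = \<one>\<^bsub>Q\<^esub>"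
      if "fst y = fst x" for y
      using in_k[OF that] hom_append[OF assms(5), of "[y]" ?u] triv[OF in_k[OF that]]
      by (auto simp: reduced_words_of_length_def)
    \<comment> \<open>Both are left inverses of \<open>\<phi> ?u\<close>.\<close>
    have "\<phi> [inv_letter x] = \<phi> [x]"
      using y[of x] y[of "inv_letter x"] car by (metis H.r_cancel inv_letter_simps(2))
    then have "\<phi> [x] \<otimes>\<^bsub>Q\<^esub> \<phi> [x] = \<one>\<^bsub>Q\<^esub>"
      using hom_inv_word[OF assms(3,5) y(1)[of x]] by (simp add: inv_word_def)
    then show ?thesis
      using left_ordered_square_one[OF assms(3,4) car[OF y(1)]] by simp
  qed
  show ?thesis
    using assms(7)
  proof (induction w)
    case Nil
    then show ?case using hom_one by (simp add: free_group_def)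
  next
    case (Cons x w)
    then show ?case
      using hom_append[OF assms(5), of "[x]" w] letter[of x]
      by (auto simp: reduced_words_def)
  qed
qed

lemma hom_trivial_if_block_relators:
  assumes "n \<ge> 2" "1 \<le> k" "group Q" "left_ordered Q r" "\<phi> \<in> hom (free_group n) Q"
    and hit: "\<And>T v. half_system n k T \<Longrightarrow> v \<in> reduced_words_of_length n k \<Longrightarrow>
      \<exists>w \<in> reduced_words n \<inter> block_words T v. \<phi> w = \<one>\<^bsub>Q\<^esub>"
    and "w \<in> reduced_words n"
  shows "\<phi> w = \<one>\<^bsub>Q\<^esub>"
proof -
  interpret group_hom "free_group n" Q \<phi>
    using assms(3,5) by (simp add: group_hom_def group_hom_axioms_def group_free_group)
  have car: "\<phi> u \<in> carrier Q" if "u \<in> reduced_words n" for u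
    using that hom_closed by (simp add: free_group_def)
  have r: "total_on (carrier Q) r" "antisym r" "refl_on (carrier Q) r" "trans r"
    using assms(4) by (auto simp: left_ordered_def linear_order_on_def partial_order_on_def preorder_on_def)
  have mono: "(f \<otimes>\<^bsub>Q\<^esub> g, f \<otimes>\<^bsub>Q\<^esub> h) \<in> r"
    if "(g, h) \<in> r" "f \<in> carrier Q" "g \<in> carrier Q" "h \<in> carrier Q" for f g h
    using assms(4) that by (auto simp: left_ordered_def)
  \<comment> \<open>This set depends on \<open>\<phi>\<close> and \<open>r\<close>, which is why
    \<open>hit\<close> ranges over all half systems.\<close>
  define T where "T = {w \<in> reduced_words n. length w \<le> k \<and> (\<one>\<^bsub>Q\<^esub>, \<phi> w) \<in> r}"
  have total: "(\<one>\<^bsub>Q\<^esub>, \<phi> u) \<in> r \<or> (\<one>\<^bsub>Q\<^esub>, \<phi> (inv_word u)) \<in> r" if u: "u \<in> reduced_words n" for u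
  proof -
    have "(\<one>\<^bsub>Q\<^esub>, \<phi> u) \<in> r \<or> (\<phi> u, \<one>\<^bsub>Q\<^esub>) \<in> r"
      using r(1,3) car[OF u] by (metis H.one_closed refl_onD total_on_def)
    then show ?thesis
      using mono[of "\<phi> u" "\<one>\<^bsub>Q\<^esub>" "\<phi> (inv_word u)"] car[OF u] car[OF inv_word_in[OF u]]
        hom_inv_word[OF assms(3,5) u] by auto
  qed
  have half: "half_system n k T"
    using total by (auto simp: half_system_def T_def inv_word_in)
  \<comment> \<open>Appending a block multiplies on the right by an element \<ge> 1, so left
    invariance makes the images increase from \<open>\<phi> v\<close> on.\<close>
  have block: "(\<phi> v, \<phi> u) \<in> r" if "u \<in> block_words T v" "u \<in> reduced_words n" for u v
    using that
  proof (induction u rule: block_words.induct)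
    case start
    then show ?case using r(3) car by (auto dest: refl_onD)
  next
    case (extend w u)
    note wu = hom_append[OF assms(5) extend.prems]
    have "(\<phi> w \<otimes>\<^bsub>Q\<^esub> \<one>\<^bsub>Q\<^esub>, \<phi> w \<otimes>\<^bsub>Q\<^esub> \<phi> u) \<in> r"
      using extend.hyps(2) wu car by (intro mono) (auto simp: T_def)
    then show ?case
      using extend.IH[OF wu(1)] wu car r(4) by (auto dest: transD)
  qed
  have le_one: "(\<phi> v, \<one>\<^bsub>Q\<^esub>) \<in> r" if "v \<in> reduced_words_of_length n k" for v
    using hit[OF half that] block[of _ v] by (metis IntE)
  have "\<phi> v = \<one>\<^bsub>Q\<^esub>" if v: "v \<in> reduced_words_of_length n k" for v
  proof -
    have v': "v \<in> reduced_words n" "inv_word v \<in> reduced_words_of_length n k"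
      using v by (auto simp: reduced_words_of_length_def inv_word_in)
    \<comment> \<open>The reverse inequality \<open>1 \<le> \<phi> v\<close> comes from
      \<open>\<phi> (inv_word v) \<le> 1\<close>, multiplied on the left by
      \<open>\<phi> v\<close>.\<close>
    have "(\<phi> v \<otimes>\<^bsub>Q\<^esub> \<phi> (inv_word v), \<phi> v \<otimes>\<^bsub>Q\<^esub> \<one>\<^bsub>Q\<^esub>) \<in> r"
      using le_one[OF v'(2)] v' car by (intro mono) (auto simp: reduced_words_of_length_def)
    moreover have "\<phi> v \<otimes>\<^bsub>Q\<^esub> \<phi> (inv_word v) = \<one>\<^bsub>Q\<^esub>"
      using hom_inv_word[OF assms(3,5) inv_word_in[OF v'(1)]] by simp
    ultimately show ?thesis
      using le_one[OF v] car[OF v'(1)] r(2) by (auto dest: antisymD)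
  qed
  then show ?thesis
    using hom_trivial_if_trivial_on_length[OF assms(1-5) _ assms(7)] by blast
qed

text \<open>A quotient of the presented group is an image of the free group in which
  \<open>R\<close> becomes trivial. The condition \<open>hit\<close> is all that randomness has to
  supply.\<close>

lemma no_left_orderable_quotient:
  assumes "n \<ge> 2" "1 \<le> k" "R \<subseteq> reduced_words n"
    and hit: "\<And>T v. half_system n k T \<Longrightarrow> v \<in> reduced_words_of_length n k \<Longrightarrow>
      R \<inter> block_words T v \<noteq> {}"
    and N: "N \<lhd> presented_group n R" and lo: "left_orderable (presented_group n R Mod N)"
  shows "trivial_group (presented_group n R Mod N)"
proof -
  define F where "F = free_group n"
  define K where "K = normal_closure F R"
  define G where "G = presented_group n R"
  define Q where "Q = G Mod N"
  have carF: "carrier F = reduced_words n" by (simp add: F_def free_group_def)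
  have G: "G = F Mod K" by (simp add: G_def F_def K_def presented_group_def)
  interpret F: group F unfolding F_def by (rule group_free_group)
  interpret K: normal K F
    unfolding K_def using assms(3) by (intro F.normal_normal_closure) (simp add: carF)
  interpret N: normal N G using N by (simp add: G_def)
  have Q: "group Q" unfolding Q_def by (rule N.factorgroup_is_group)
  interpret Q: group Q by (rule Q)
  obtain r where r: "left_ordered Q r"
    using lo by (auto simp: left_orderable_def Q_def G_def)
  \<comment> \<open>The composite of the two coset projections, from the free group to
    \<open>G\<close> and from \<open>G\<close> to \<open>Q\<close>.\<close>
  define \<phi> where "\<phi> = (\<lambda>x. N #>\<^bsub>G\<^esub> x) \<circ> (\<lambda>w. K #>\<^bsub>F\<^esub> w)"
  have "\<phi> \<in> hom F Q"
    unfolding \<phi>_def Q_def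
    by (rule hom_compose[OF _ N.r_coset_hom_Mod]) (use K.r_coset_hom_Mod G in simp)
  then have hom: "\<phi> \<in> hom (free_group n) Q" by (simp add: F_def)
  have R: "\<phi> w = \<one>\<^bsub>Q\<^esub>" if "w \<in> R" for w
  proof -
    have "w \<in> K" using that hull_subset[of R "\<lambda>N. N \<lhd> F"] by (auto simp: K_def normal_closure_def)
    then have "K #>\<^bsub>F\<^esub> w = \<one>\<^bsub>G\<^esub>"
      using K.rcos_const by (simp add: G FactGroup_def)
    then show ?thesis
      using N.rcos_const[of "\<one>\<^bsub>G\<^esub>"] N.one_closed by (simp add: \<phi>_def Q_def FactGroup_def)
  qed
  have triv: "\<phi> w = \<one>\<^bsub>Q\<^esub>" if "w \<in> reduced_words n" for w
  proof (rule hom_trivial_if_block_relators[OF assms(1,2) Q r hom _ that])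
    fix T v assume "half_system n k T" "v \<in> reduced_words_of_length n k"
    from hit[OF this] show "\<exists>w \<in> reduced_words n \<inter> block_words T v. \<phi> w = \<one>\<^bsub>Q\<^esub>"
      using assms(3) R by blast
  qed
  have "carrier Q \<subseteq> {\<one>\<^bsub>Q\<^esub>}"
  proof
    fix y assume "y \<in> carrier Q"
    then obtain x where x: "x \<in> carrier G" "y = N #>\<^bsub>G\<^esub> x"
      by (auto simp: Q_def FactGroup_def RCOSETS_def)
    then obtain w where "w \<in> carrier F" "x = K #>\<^bsub>F\<^esub> w"
      by (auto simp: G FactGroup_def RCOSETS_def)
    then show "y \<in> {\<one>\<^bsub>Q\<^esub>}" using x triv by (auto simp: \<phi>_def carF)
  qed
  then show ?thesis
    using Q.trivial_group_subset by (simp add: Q_def G_def)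
qed

section \<open>Union bound over half systems and initial blocks\<close>

theorem theorem1p5:
  fixes n :: nat and d :: real
  assumes "n \<ge> 2" and "0 < d" and "d < 1"
  shows "with_overwhelming_probability n d
    (\<lambda>G. \<not> (\<exists>N. N \<lhd> G \<and> \<not> trivial_group (G Mod N) \<and> left_orderable (G Mod N)))"
proof -
  obtain k' where k': "inverse (real (Suc k')) < d" using reals_Archimedean[OF assms(2)] by blast
  define k where "k = Suc k'"
  have k: "1 \<le> k" "1 / real k < d" using k' by (auto simp: k_def inverse_eq_divide)
  \<comment> \<open>Since \<open>k\<close> depends only on \<open>d\<close>, this finite index set
    is the same for every \<open>L\<close>, and the union bound can be sent to its limit term by
    term.\<close>
  define I where "I = {T. half_system n k T} \<times> reduced_words_of_length n k"
  have I: "finite I" by (simp add: I_def finite_half_systems finite_reduced_words_of_length)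
  let ?P = "\<lambda>G. \<not> (\<exists>N. N \<lhd> G \<and> \<not> trivial_group (G Mod N) \<and> left_orderable (G Mod N))"
  let ?E = "\<lambda>(T, v). {R. set R \<inter> block_words T v = {}}"
  let ?pr = "\<lambda>L. measure_pmf.prob (random_relators n d L)"
  have bound: "1 - (\<Sum>i\<in>I. ?pr L (?E i)) \<le> measure_pmf.prob (random_group n d L) {G. ?P G}" for L
  proof -
    have good: "?P (presented_group n (set R))"
      if R: "R \<in> set_pmf (random_relators n d L)" "R \<notin> (\<Union>i\<in>I. ?E i)" for R
    proof -
      have "set R \<subseteq> reduced_words n"
        using R(1) assms(1) reduced_words_of_length_nonempty[of n L]
        by (auto simp: random_relators_def set_replicate_pmf finite_reduced_words_of_length)
           (auto simp: reduced_words_of_length_def)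
      then show ?thesis
        using no_left_orderable_quotient[OF assms(1) k(1), of "set R"] R(2)
        by (auto simp: I_def)
    qed
    have "1 - ?pr L (\<Union>i\<in>I. ?E i) = ?pr L (- (\<Union>i\<in>I. ?E i))"
      using measure_pmf.prob_compl[of "\<Union>i\<in>I. ?E i" "random_relators n d L"]
      by (simp add: Compl_eq_Diff_UNIV)
    \<comment> \<open>\<open>good\<close> speaks only of lists in the support, whose entries are
      reduced words, so the inclusion of events holds almost everywhere.\<close>
    also have "\<dots> \<le> ?pr L {R. ?P (presented_group n (set R))}"
      by (rule measure_pmf.finite_measure_mono_AE) (use good in \<open>auto simp: AE_measure_pmf_iff\<close>)
    also have "\<dots> = measure_pmf.prob (random_group n d L) {G. ?P G}"
      by (simp add: random_group_def vimage_def)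
    finally show ?thesis
      using measure_pmf.finite_measure_subadditive_finite[OF I, of ?E "random_relators n d L"]
      by simp
  qed
  have "(\<lambda>L. 1 - (\<Sum>i\<in>I. ?pr L (?E i))) \<longlonglongrightarrow> 1 - (\<Sum>i\<in>I. 0)"
  proof (intro tendsto_intros)
    fix i assume "i \<in> I"
    then show "(\<lambda>L. ?pr L (?E i)) \<longlonglongrightarrow> 0"
      using prob_no_block_relator_tendsto[OF assms(1) _ k(1) _ k(2)] by (auto simp: I_def)
  qed
  then have lim: "(\<lambda>L. 1 - (\<Sum>i\<in>I. ?pr L (?E i))) \<longlonglongrightarrow> 1" by simp
  show ?thesis
    unfolding with_overwhelming_probability_def
    by (rule tendsto_sandwich[OF _ _ lim tendsto_const]) (use bound in auto)
qed

end
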